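(* The generating function $A(x,v)=\sum_{n\ge1}\sum_{m=1}^n a(n,m)x^nv^m$ satisfies, as formal power series, $$A(x,v)=\frac{xv}{1-xv}\left(1-xC(x)\right)+\frac{xv}{1-xv}A\!\left(x,\frac{1}{1-xv}\right).$$
   Context: For a positive integer $n$, $\mathcal{L}_n$ denotes the set of all words $a=(a_1,a_2,\ldots,a_n)$ over the alphabet of non-negative integers satisfying: (i) $a_{i+1}\ge a_i-1$ for $1\le i<n$; and (ii) if $a_i=k>0$ with $i$ minimal (i.e. $i$ is the position of the left-most occurrence of the letter $k$), then there exist $i_1<i<i_2$ such that $a_{i_1}=a_{i_2}=k-1$. For $1\le m\le n$, $a(n,m)$ is the number of words in $\mathcal{L}_n$ containing exactly $m$ zeros. $C(x)=\sum_{n\ge0}C_nx^n=\frac{1-\sqrt{1-4x}}{2x}$, where $C_n=\frac{1}{n+1}\binom{2n}{n}$ is the $n$-th Catalan number. *)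

theory Defs
  imports Complex_Main "HOL-Computational_Algebra.Formal_Power_Series"
begin

unbundle fps_syntax

text \<open>Words of length \<open>n\<close> are lists, so the letter \<open>a\<^sub>i\<close> is \<open>a ! (i - 1)\<close>.
  The condition \<open>a\<^sub>i\<^sub>+\<^sub>1 \<ge> a\<^sub>i - 1\<close> is written without subtraction on the naturals.\<close>

definition L_words :: "nat \<Rightarrow> nat list set" where
  "L_words n = {a. length a = n \<and>
     (\<forall>i. Suc i < n \<longrightarrow> a ! i \<le> a ! Suc i + 1) \<and>
     (\<forall>i < n. a ! i > 0 \<and> (\<forall>j < i. a ! j \<noteq> a ! i) \<longrightarrow>
        (\<exists>i1 i2. i1 < i \<and> i < i2 \<and> i2 < n \<and> a ! i1 = a ! i - 1 \<and> a ! i2 = a ! i - 1))}"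

definition num_words :: "nat \<Rightarrow> nat \<Rightarrow> nat" where
  "num_words n m = card {a \<in> L_words n. count_list a 0 = m}"

text \<open>Bivariate formal power series in \<open>x\<close> and \<open>v\<close> are series in \<open>x\<close> whose coefficients are
  series in \<open>v\<close>.\<close>

abbreviation X_var :: "rat fps fps" where
  "X_var \<equiv> fps_X"

abbreviation V_var :: "rat fps fps" where
  "V_var \<equiv> fps_const fps_X"

definition catalan_fps :: "rat fps fps" where
  "catalan_fps = Abs_fps (\<lambda>n. fps_const (of_nat ((2 * n) choose n) / of_nat (n + 1)))"

text \<open>The series \<open>A(x, u)\<close>, where \<open>u\<close> may be any bivariate series. The infinite sum is taken in
  the topology of formal power series in \<open>x\<close>, in which it always converges (see below), as its
  \<open>n\<close>-th term is divisible by \<open>x\<^sup>n\<close>; the term for \<open>n = 0\<close> is an empty sum.\<close>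

definition A_series :: "rat fps fps \<Rightarrow> rat fps fps" where
  "A_series u = (\<Sum>n. \<Sum>m=1..n. of_nat (num_words n m) * X_var ^ n * u ^ m)"

text \<open>The remaining facts confirm that the cardinalities, the infinite sum and the quotients by
  \<open>1 - x v\<close> are not default values.\<close>

lemma finite_L_words: "finite (L_words n)"
proof -
  have occ: "k' \<in> set a" if a: "a \<in> L_words n" and "k \<in> set a" "k' \<le> k" for a k k'
    using that(2,3)
  proof (induction k)
    case 0
    then show ?case by simp
  next
    case (Suc k)
    define i where "i = (LEAST i. i < n \<and> a ! i = Suc k)"
    have len: "length a = n" using a by (simp add: L_words_def)
    have ex: "\<exists>i. i < n \<and> a ! i = Suc k"
      using Suc.prems(1) len by (auto simp: in_set_conv_nth)
    have i: "i < n" "a ! i = Suc k"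
      using LeastI_ex[OF ex] by (auto simp: i_def)
    have least: "\<forall>j<i. a ! j \<noteq> a ! i"
      using i not_less_Least[of _ "\<lambda>i. i < n \<and> a ! i = Suc k"]
      by (fastforce simp: i_def[symmetric])
    have "\<exists>i1 i2. i1 < i \<and> i < i2 \<and> i2 < n \<and> a ! i1 = a ! i - 1 \<and> a ! i2 = a ! i - 1"
      using a i(1) least Suc_neq_Zero[of k] unfolding L_words_def mem_Collect_eq i(2)
      by (metis i(2) zero_less_Suc)
    then have "k \<in> set a" using i len by (auto simp: in_set_conv_nth)
    then show ?case using Suc by (cases "k' = Suc k") auto
  qed
  have "L_words n \<subseteq> {a. set a \<subseteq> {..n} \<and> length a = n}"
  proof
    fix a assume a: "a \<in> L_words n"
    then have len: "length a = n" by (simp add: L_words_def)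
    have "k \<le> n" if "k \<in> set a" for k
    proof -
      have "{..k} \<subseteq> set a" using occ[OF a that] by auto
      then have "card {..k} \<le> card (set a)" by (intro card_mono) auto
      then show ?thesis using card_length[of a] len by simp
    qed
    then show "a \<in> {a. set a \<subseteq> {..n} \<and> length a = n}" using len by auto
  qed
  then show ?thesis by (rule finite_subset) (simp add: finite_lists_length_eq)
qed

lemma A_series_sums:
  "(\<lambda>n. \<Sum>m=1..n. of_nat (num_words n m) * X_var ^ n * u ^ m) sums A_series u"
proof -
  define t where "t = (\<lambda>n. \<Sum>m=1..n. of_nat (num_words n m) * X_var ^ n * u ^ m)"
  have t: "t n = X_var ^ n * (\<Sum>m=1..n. of_nat (num_words n m) * u ^ m)" for n
    by (simp add: t_def sum_distrib_left mult_ac)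
  have zero: "t n $ k = 0" if "k < n" for n k
    using that by (simp add: t fps_X_power_mult_nth)
  have "t sums Abs_fps (\<lambda>k. \<Sum>n\<le>k. t n $ k)"
    unfolding sums_def
  proof (rule tendsto_fpsI)
    fix k
    show "\<forall>\<^sub>F N in sequentially. (\<Sum>n<N. t n) $ k = Abs_fps (\<lambda>k. \<Sum>n\<le>k. t n $ k) $ k"
      using eventually_gt_at_top[of k]
    proof eventually_elim
      case (elim N)
      have "(\<Sum>n<N. t n $ k) = (\<Sum>n\<le>k. t n $ k)"
        using elim by (intro sum.mono_neutral_right) (auto simp: zero)
      then show ?case by (simp add: fps_sum_nth)
    qed
  qed
  then show ?thesis
    unfolding A_series_def t_def[symmetric] by (simp add: sums_iff)
qed

lemma A_series_nth:
  "A_series V_var $ n $ m = (if 1 \<le> m \<and> m \<le> n then of_nat (num_words n m) else 0)"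
proof -
  define t where "t = (\<lambda>n. \<Sum>m=1..n. of_nat (num_words n m) * X_var ^ n * V_var ^ m)"
  have summand: "(of_nat c * X_var ^ k * V_var ^ m) $ n = (if n = k then of_nat c * fps_X ^ m else 0)"
    for c k m :: nat
    by (simp add: mult.assoc fps_X_power_mult_nth)
  have nth: "t k $ n = (if n = k then \<Sum>m=1..n. of_nat (num_words n m) * fps_X ^ m else 0)" for k
    by (simp add: t_def fps_sum_nth summand del: fps_const_power)
  have "(\<lambda>N. \<Sum>k<N. t k) \<longlonglongrightarrow> A_series V_var"
    using A_series_sums[of V_var] unfolding sums_def t_def .
  then have "\<forall>\<^sub>F N in sequentially. (\<Sum>k<N. t k) $ n = A_series V_var $ n"
    unfolding tendsto_fps_iff by blast
  then have "\<forall>\<^sub>F N in sequentially. (\<Sum>k<N. t k) $ n = A_series V_var $ n \<and> n < N"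
    using eventually_gt_at_top[of n] by (rule eventually_conj)
  then obtain N where N: "(\<Sum>k<N. t k) $ n = A_series V_var $ n" "n < N"
    unfolding eventually_sequentially by blast
  then have "A_series V_var $ n = (\<Sum>m=1..n. of_nat (num_words n m) * fps_X ^ m)"
    by (simp add: fps_sum_nth nth flip: N(1))
  then show ?thesis
    by (auto simp: fps_sum_nth fps_of_nat [symmetric] fps_X_power_iff if_distrib
        cong: if_cong)
qed

lemma one_minus_xv_divide: "f / (1 - X_var * V_var) * (1 - X_var * V_var) = f"
proof -
  let ?g = "1 - X_var * V_var"
  have "?g $ 0 = 1" by simp
  have "inverse ?g * ?g = 1"
  proof -
    have "inverse (1 :: rat fps) = 1" by simp
    then have "inverse ?g = fps_right_inverse ?g 1"
      by (simp only: fps_inverse_def[of ?g] \<open>?g $ 0 = 1\<close>)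
    then show ?thesis
      using fps_right_inverse[of ?g 1] by (simp add: mult.commute)
  qed
  with \<open>?g $ 0 = 1\<close> show ?thesis
    by (simp add: fps_divide_unit mult.assoc)
qed

end

theory Submission
  imports Defs
begin

text \<open>Delete all zeros from a word \<open>a\<close> of the language and decrease every other letter by one. The
  result \<open>b\<close> is again a word of the language (\<open>supported_iff_shrink\<close>, \<open>gentle_shrink\<close>), and it
  records everything about \<open>a\<close> except where the zeros were. A letter before a zero is at most one,
  so zeros may be put back only at the front and behind the letters that come from the zeros of
  \<open>b\<close>. At the front at least one zero is needed, since the first letter of a word is
  zero. At each of the other places any number is possible, except that not all of these numbers
  vanish: the first one of \<open>a\<close> must have a zero to its right. If \<open>b\<close> has length \<open>n\<close> and \<open>m\<close> zeros, the
  words \<open>a\<close> over \<open>b\<close> therefore contribute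
  \<open>x v / (1 - x v) * x\<^sup>n * (1 / (1 - x v)\<^sup>m - 1)\<close>, while the words of zeros alone contribute
  \<open>x v / (1 - x v)\<close>. Summing over \<open>b\<close> gives, for every series \<open>u\<close> in the place of \<open>v\<close>
  (\<open>A_series_recurrence\<close>),
  \<open>A(x, u) = x u / (1 - x u) * (1 - A(x, 1) + A(x, 1 / (1 - x u)))\<close>.

  It remains to see that \<open>A(x, 1) = x C(x)\<close>. The recurrence holds for all \<open>u\<close>, and it determines \<open>A\<close>
  because each use gains a factor \<open>x\<close>. The series \<open>B(x, u) = x u / (1 - x C u)\<close> satisfies the
  recurrence with \<open>B(x, 1) = x C\<close>, as a consequence of \<open>C = 1 + x C\<^sup>2\<close> (\<open>ballot_series_recurrence\<close>).
  Hence \<open>A = B\<close>, and in particular \<open>A(x, 1) = x C(x)\<close> (\<open>A_series_at_one\<close>).\<close>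


section \<open>The Catalan series\<close>

lemma central_binomial_Suc:
  "Suc n * (2 * Suc n choose Suc n) = (4 * n + 2) * (2 * n choose n)"
proof -
  have 1: "Suc n * (2 * Suc n choose Suc n) = 2 * (Suc n * (Suc (2 * n) choose n))"
    using Suc_times_binomial[of n "Suc (2 * n)"] by simp
  have "Suc (2 * n) choose n = Suc (2 * n) choose Suc n"
    using binomial_symmetric[of n "Suc (2 * n)"] by simp
  then have "Suc n * (Suc (2 * n) choose n) = Suc (2 * n) * (2 * n choose n)"
    using Suc_times_binomial[of n "2 * n"] by simp
  then show ?thesis unfolding 1 by simp
qed

text \<open>With \<open>q = 1 - 4x\<close> and \<open>S = 1 - 2xc\<close> the claim is \<open>S\<^sup>2 = q\<close>, that is, \<open>S\<close> is the square root of \<open>q\<close>.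
  The recurrence for the coefficients of \<open>c\<close> is the differential equation \<open>q S' = - 2 S\<close> of that
  square root. It implies \<open>q T' = - 4 T\<close> for \<open>T = S\<^sup>2\<close>, and this equation together with the constant
  term one determines \<open>T\<close> to be \<open>q\<close>.\<close>
lemma catalan_functional_equation_of_recurrence:
  fixes c :: "'a :: {idom, semiring_char_0} fps"
  assumes c0: "c $ 0 = 1"
    and c_Suc: "\<And>n. of_nat (n + 2) * c $ Suc n = of_nat (4 * n + 2) * c $ n"
  shows "c = 1 + fps_X * c\<^sup>2"
proof -
  define S where "S = 1 - 2 * fps_X * c"
  define q where "q = (1 - 4 * fps_X :: 'a fps)"
  have S_nth: "S $ n = (if n = 0 then 1 else - 2 * c $ (n - 1))" for n
    by (simp add: S_def mult.assoc numeral_fps_const)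
  have q_nth: "(q * f) $ n = f $ n - (if n = 0 then 0 else 4 * f $ (n - 1))" for f n
    by (simp add: q_def left_diff_distrib mult.assoc numeral_fps_const)
  have S': "q * fps_deriv S = - 2 * S"
  proof (rule fps_ext)
    fix n :: nat
    show "(q * fps_deriv S) $ n = (- 2 * S) $ n"
    proof (cases n)
      case 0
      then show ?thesis by (simp add: q_def S_nth c0 numeral_fps_const)
    next
      case (Suc k)
      have "(q * fps_deriv S) $ n
          = - 2 * (of_nat (k + 2) * c $ Suc k) + 4 * (2 * (of_nat (Suc k) * c $ k))"
        by (simp add: q_nth S_nth Suc algebra_simps)
      also have "\<dots> = 4 * c $ k"
        unfolding c_Suc by (simp add: algebra_simps)
      also have "\<dots> = (- 2 * S) $ n"
        by (simp add: S_nth Suc numeral_fps_const)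
      finally show ?thesis .
    qed
  qed
  define T where "T = S * S"
  have T0: "T $ 0 = 1" by (simp add: T_def S_nth)
  have "q * fps_deriv T = 2 * S * (q * fps_deriv S)"
    by (simp add: T_def mult_ac mult_2 distrib_left)
  also have "\<dots> = - 4 * T" unfolding S' T_def by (simp add: mult_ac)
  finally have T': "q * fps_deriv T = - 4 * T" .
  have T_Suc: "of_nat (Suc n) * T $ Suc n = 4 * (of_nat n - 1) * T $ n" for n
  proof -
    have "(q * fps_deriv T) $ n = - 4 * T $ n"
      unfolding T' by (simp add: numeral_fps_const)
    then show ?thesis
      unfolding q_nth fps_deriv_nth by (cases n) (auto simp: algebra_simps)
  qed
  have T1: "T $ 1 = - 4"
    using T_Suc[of 0] by (simp add: T0)
  have T_zero: "T $ (n + 2) = 0" for n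
  proof (induction n)
    case 0
    have "of_nat 2 * T $ 2 = 0"
      using T_Suc[of 1] by (simp add: numeral_2_eq_2)
    then show ?case by (simp add: numeral_2_eq_2)
  next
    case (Suc n)
    have "of_nat (Suc (n + 2)) * T $ Suc (n + 2) = 0"
      unfolding T_Suc Suc.IH by simp
    then have "T $ Suc (n + 2) = 0" by (simp del: of_nat_Suc)
    then show ?case by simp
  qed
  have "T = q"
  proof (rule fps_ext)
    fix n :: nat
    consider "n = 0" | "n = 1" | m where "n = m + 2"
      by (metis One_nat_def add_2_eq_Suc' old.nat.exhaust)
    then show "T $ n = q $ n"
      using q_nth[of 1 n] by cases (simp_all add: q_def T0 T1[simplified] T_zero[simplified])
  qed
  then have "4 * fps_X * (c - (1 + fps_X * c\<^sup>2)) = 0"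
    unfolding T_def S_def q_def by (simp add: algebra_simps power2_eq_square)
  moreover have "4 * fps_X \<noteq> (0 :: 'a fps)"
    by (simp add: numeral_fps_const)
  ultimately show ?thesis by simp
qed

lemma catalan_fps_functional_equation: "catalan_fps = 1 + X_var * catalan_fps\<^sup>2"
proof (rule catalan_functional_equation_of_recurrence)
  show "catalan_fps $ 0 = 1" by (simp add: catalan_fps_def)
  fix n
  define r :: "nat \<Rightarrow> rat" where "r n = of_nat ((2 * n) choose n) / of_nat (n + 1)" for n
  have "of_nat (Suc n) * (of_nat (n + 2) * r (Suc n)) = of_nat (Suc n * (2 * Suc n choose Suc n))"
    by (simp add: r_def del: binomial_Suc_Suc mult_Suc_right) (simp add: algebra_simps)
  also have "\<dots> = of_nat (Suc n) * (of_nat (4 * n + 2) * r n)"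
    unfolding central_binomial_Suc by (simp add: r_def) (simp add: algebra_simps)
  finally have "of_nat (n + 2) * r (Suc n) = of_nat (4 * n + 2) * r n"
    by (simp del: of_nat_Suc of_nat_add)
  then have "fps_const (of_nat (n + 2) * r (Suc n)) = fps_const (of_nat (4 * n + 2) * r n)"
    by simp
  then show "of_nat (n + 2) * catalan_fps $ Suc n = of_nat (4 * n + 2) * catalan_fps $ n"
    unfolding catalan_fps_def fps_nth_Abs_fps r_def fps_of_nat[symmetric] fps_const_mult .
qed


section \<open>Weight series of languages\<close>

text \<open>A language has a weight series as soon as it has only finitely many words of each length. Since the
  weight of a word of length \<open>n\<close> is divisible by \<open>x\<^sup>n\<close>, the sum over the language is then defined for
  every series \<open>u\<close> marking the zeros, whatever its constant term. Decompositions of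
  languages then become identities of series directly, without numbers of words in between.\<close>
definition graded_finite :: "nat list set \<Rightarrow> bool" where
  "graded_finite W \<longleftrightarrow> (\<forall>k. finite {w \<in> W. length w \<le> k})"

definition weight :: "'a :: comm_ring_1 fps \<Rightarrow> nat list \<Rightarrow> 'a fps" where
  "weight u w = fps_X ^ length w * u ^ count_list w 0"

definition weight_series :: "nat list set \<Rightarrow> 'a :: comm_ring_1 fps \<Rightarrow> 'a fps" where
  "weight_series W u = Abs_fps (\<lambda>k. \<Sum>w | w \<in> W \<and> length w \<le> k. weight u w $ k)"

lemma graded_finiteD: "graded_finite W \<Longrightarrow> finite {w \<in> W. length w \<le> k}"
  by (simp add: graded_finite_def)

lemma graded_finite_subset: "graded_finite W \<Longrightarrow> V \<subseteq> W \<Longrightarrow> graded_finite V"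
  unfolding graded_finite_def by (blast intro: finite_subset[rotated])

lemma graded_finite_singleton: "graded_finite {w}"
  by (simp add: graded_finite_def)

lemma graded_finite_Un: "graded_finite V \<Longrightarrow> graded_finite W \<Longrightarrow> graded_finite (V \<union> W)"
  by (simp add: graded_finite_def conj_disj_distribR Collect_disj_eq)

lemma weight_nth_eq_0: "k < length w \<Longrightarrow> weight u w $ k = 0"
  by (simp add: weight_def fps_X_power_mult_nth)

lemma weight_nth_neq_0D: "weight u w $ k \<noteq> 0 \<Longrightarrow> length w \<le> k"
  using weight_nth_eq_0 by (metis not_le)

lemma weight_Cons: "weight u (c # w) = fps_X * (if c = 0 then u else 1) * weight u w"
  by (simp add: weight_def mult_ac)

text \<open>The laws of a ring apply to finite sums, and reach weight series through such truncations.\<close>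
lemma weight_series_nth_truncate:
  assumes "graded_finite W" "k \<le> N"
  shows "weight_series W u $ k = (\<Sum>w | w \<in> W \<and> length w \<le> N. weight u w) $ k"
  unfolding weight_series_def fps_nth_Abs_fps fps_sum_nth
  using assms by (intro sum.mono_neutral_left) (auto simp: graded_finite_def dest!: weight_nth_neq_0D)

lemma fps_mult_nth_cong:
  fixes f g h :: "'a :: comm_ring_1 fps"
  assumes "\<And>j. j \<le> k \<Longrightarrow> f $ j = g $ j"
  shows "(h * f) $ k = (h * g) $ k"
  using assms by (simp add: fps_mult_nth)

lemma weight_series_Cons:
  assumes "graded_finite W"
  shows "weight_series ((#) c ` W) u = fps_X * (if c = 0 then u else 1) * weight_series W u"
    (is "_ = ?h * _")
proof (rule fps_ext)
  fix k
  have "weight_series ((#) c ` W) u $ k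
      = (\<Sum>w \<in> (#) c ` {w \<in> W. Suc (length w) \<le> k}. weight u w $ k)"
    unfolding weight_series_def fps_nth_Abs_fps by (intro sum.cong) auto
  also have "\<dots> = (\<Sum>w | w \<in> W \<and> Suc (length w) \<le> k. (?h * weight u w) $ k)"
    by (subst sum.reindex) (simp_all add: weight_Cons)
  also have "\<dots> = (\<Sum>w | w \<in> W \<and> length w \<le> k. (?h * weight u w) $ k)"
    using assms unfolding weight_Cons[symmetric]
    by (intro sum.mono_neutral_left) (auto simp: graded_finite_def dest!: weight_nth_neq_0D)
  also have "\<dots> = (?h * (\<Sum>w | w \<in> W \<and> length w \<le> k. weight u w)) $ k"
    by (simp only: sum_distrib_left fps_sum_nth)
  also have "\<dots> = (?h * weight_series W u) $ k"
    by (rule fps_mult_nth_cong) (simp add: weight_series_nth_truncate[OF assms])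
  finally show "weight_series ((#) c ` W) u $ k = (?h * weight_series W u) $ k" .
qed

lemma weight_series_Un:
  assumes "graded_finite V" "graded_finite W" "V \<inter> W = {}"
  shows "weight_series (V \<union> W) u = weight_series V u + weight_series W u"
proof (rule fps_ext)
  fix k
  have "{w. w \<in> V \<union> W \<and> length w \<le> k} = {w \<in> V. length w \<le> k} \<union> {w \<in> W. length w \<le> k}"
    by auto
  then show "weight_series (V \<union> W) u $ k = (weight_series V u + weight_series W u) $ k"
    unfolding weight_series_def using assms
    by (simp, intro sum.union_disjoint) (auto simp: graded_finite_def)
qed

lemma weight_series_singleton: "weight_series {w} u = weight u w"
proof (rule fps_ext)
  fix k
  have "{v. v \<in> {w} \<and> length v \<le> k} = (if length w \<le> k then {w} else {})" by auto
  then show "weight_series {w} u $ k = weight u w $ k"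
    by (simp add: weight_series_def weight_nth_eq_0)
qed

lemma weight_series_remove:
  assumes "graded_finite W" "w \<in> W"
  shows "weight_series (W - {w}) u = weight_series W u - weight u w"
proof -
  have "weight_series ((W - {w}) \<union> {w}) u = weight_series (W - {w}) u + weight_series {w} u"
    by (intro weight_series_Un graded_finite_singleton graded_finite_subset[OF assms(1)]) auto
  also have "(W - {w}) \<union> {w} = W" using assms(2) by blast
  finally show ?thesis by (simp add: weight_series_singleton)
qed

lemma truncated_UN_eq:
  fixes B :: "nat list set"
  assumes "\<And>b w. b \<in> B \<Longrightarrow> w \<in> E b \<Longrightarrow> length b \<le> length w"
  shows "{w. w \<in> (\<Union>b\<in>B. E b) \<and> length w \<le> k}
       = (\<Union>b\<in>{b \<in> B. length b \<le> k}. {w \<in> E b. length w \<le> k})"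
proof (intro equalityI subsetI)
  fix w assume "w \<in> {w. w \<in> (\<Union>b\<in>B. E b) \<and> length w \<le> k}"
  then obtain b where b: "b \<in> B" "w \<in> E b" "length w \<le> k" by blast
  then have "length b \<le> k" using assms[OF b(1,2)] by linarith
  with b show "w \<in> (\<Union>b\<in>{b \<in> B. length b \<le> k}. {w \<in> E b. length w \<le> k})" by blast
qed blast

lemma graded_finite_UN:
  assumes "graded_finite B" "\<And>b. b \<in> B \<Longrightarrow> graded_finite (E b)"
    and "\<And>b w. b \<in> B \<Longrightarrow> w \<in> E b \<Longrightarrow> length b \<le> length w"
  shows "graded_finite (\<Union>b\<in>B. E b)"
  unfolding graded_finite_def
proof
  fix k
  have "finite (\<Union>b\<in>{b \<in> B. length b \<le> k}. {w \<in> E b. length w \<le> k})"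
    using assms(1,2) by (simp add: graded_finite_def)
  also have "(\<Union>b\<in>{b \<in> B. length b \<le> k}. {w \<in> E b. length w \<le> k})
      = {w. w \<in> (\<Union>b\<in>B. E b) \<and> length w \<le> k}"
    by (rule truncated_UN_eq[symmetric]) (rule assms(3))
  finally show "finite {w \<in> (\<Union>b\<in>B. E b). length w \<le> k}" .
qed

lemma weight_series_UN_nth:
  assumes "graded_finite B" "\<And>b. b \<in> B \<Longrightarrow> graded_finite (E b)"
    and "\<And>b w. b \<in> B \<Longrightarrow> w \<in> E b \<Longrightarrow> length b \<le> length w"
    and "\<And>b c. b \<in> B \<Longrightarrow> c \<in> B \<Longrightarrow> b \<noteq> c \<Longrightarrow> E b \<inter> E c = {}"
  shows "weight_series (\<Union>b\<in>B. E b) u $ k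
       = (\<Sum>b | b \<in> B \<and> length b \<le> k. weight_series (E b) u $ k)"
proof -
  have "(\<Sum>w \<in> (\<Union>b\<in>{b \<in> B. length b \<le> k}. {w \<in> E b. length w \<le> k}). weight u w $ k)
      = (\<Sum>b | b \<in> B \<and> length b \<le> k. \<Sum>w | w \<in> E b \<and> length w \<le> k. weight u w $ k)"
  proof (intro sum.UNION_disjoint ballI impI)
    show "finite {b \<in> B. length b \<le> k}" using assms(1) by (rule graded_finiteD)
    show "finite {w \<in> E b. length w \<le> k}" if "b \<in> {b \<in> B. length b \<le> k}" for b
      using that assms(2) by (intro graded_finiteD) auto
    show "{w \<in> E b. length w \<le> k} \<inter> {w \<in> E c. length w \<le> k} = {}"
      if "b \<in> {b \<in> B. length b \<le> k}" "c \<in> {b \<in> B. length b \<le> k}" "b \<noteq> c" for b c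
      using that assms(4)[of b c] by auto
  qed
  also have "(\<Union>b\<in>{b \<in> B. length b \<le> k}. {w \<in> E b. length w \<le> k})
      = {w. w \<in> (\<Union>b\<in>B. E b) \<and> length w \<le> k}"
    by (rule truncated_UN_eq[symmetric]) (rule assms(3))
  finally show ?thesis
    unfolding weight_series_def fps_nth_Abs_fps .
qed

definition zero_padded :: "nat list set \<Rightarrow> nat list set" where
  "zero_padded W = {replicate j 0 @ w | j w. w \<in> W}"

lemma zero_paddedI: "w \<in> W \<Longrightarrow> replicate j 0 @ w \<in> zero_padded W"
  by (auto simp: zero_padded_def)

lemma graded_finite_zero_padded:
  assumes "graded_finite W"
  shows "graded_finite (zero_padded W)"
  unfolding graded_finite_def
proof
  fix k
  have "{w \<in> zero_padded W. length w \<le> k}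
      \<subseteq> (\<lambda>(j, w). replicate j 0 @ w) ` ({..k} \<times> {w \<in> W. length w \<le> k})"
    by (auto simp: zero_padded_def image_iff)
  then show "finite {w \<in> zero_padded W. length w \<le> k}"
    by (rule finite_subset)
      (intro finite_imageI finite_cartesian_product finite_atMost graded_finiteD[OF assms])
qed

text \<open>A word of \<open>zero_padded W\<close> lies in \<open>W\<close> or arises from a shorter one by putting a zero in front, but not
  both, because the words of \<open>W\<close> do not start with zero.\<close>
lemma weight_series_zero_padded:
  assumes fin: "graded_finite W" and "\<And>w. 0 # w \<notin> W"
  shows "(1 - fps_X * u) * weight_series (zero_padded W) u = weight_series W u"
proof -
  have "zero_padded W = W \<union> (#) 0 ` zero_padded W"
  proof (intro equalityI subsetI)
    fix v assume "v \<in> zero_padded W"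
    then obtain j w where v: "v = replicate j 0 @ w" "w \<in> W" by (auto simp: zero_padded_def)
    then show "v \<in> W \<union> (#) 0 ` zero_padded W"
      by (cases j) (auto intro: zero_paddedI)
  next
    fix v assume "v \<in> W \<union> (#) 0 ` zero_padded W"
    then show "v \<in> zero_padded W"
    proof
      assume "v \<in> W"
      then show ?thesis using zero_paddedI[of v W 0] by simp
    next
      assume "v \<in> (#) 0 ` zero_padded W"
      then obtain j w where "v = 0 # replicate j 0 @ w" "w \<in> W" by (auto simp: zero_padded_def)
      then show ?thesis using zero_paddedI[of w W "Suc j"] by simp
    qed
  qed
  moreover have "weight_series (W \<union> (#) 0 ` zero_padded W) u
      = weight_series W u + weight_series ((#) 0 ` zero_padded W) u"
    using assms graded_finite_zero_padded[OF fin] calculation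
    by (intro weight_series_Un graded_finite_subset[OF graded_finite_zero_padded[OF fin]]) auto
  ultimately have "weight_series (zero_padded W) u
      = weight_series W u + fps_X * u * weight_series (zero_padded W) u"
    using weight_series_Cons[OF graded_finite_zero_padded[OF fin], of 0 u] by simp
  then show ?thesis by (simp add: algebra_simps)
qed


section \<open>Removing the zeros of a word\<close>

abbreviation gentle :: "nat list \<Rightarrow> bool" where
  "gentle \<equiv> successively (\<lambda>x y. x \<le> Suc y)"

text \<open>Condition (ii) on the leftmost occurrence of a positive letter. The part before it is a
  \<open>takeWhile\<close> and the part from it on a \<open>dropWhile\<close>; both commute with deleting zeros, which
  positions do not.\<close>
definition supported :: "nat list \<Rightarrow> bool" where
  "supported a \<longleftrightarrow> (\<forall>k. Suc k \<in> set a \<longrightarrow>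
     k \<in> set (takeWhile (\<lambda>x. x \<noteq> Suc k) a) \<and> k \<in> set (dropWhile (\<lambda>x. x \<noteq> Suc k) a))"

definition language :: "nat list set" where
  "language = {a. gentle a \<and> supported a}"

definition shrink :: "nat list \<Rightarrow> nat list" where
  "shrink a = map (\<lambda>x. x - 1) (filter (\<lambda>x. x \<noteq> 0) a)"

lemma shrink_simps [simp]:
  "shrink [] = []"
  "shrink (0 # a) = shrink a"
  "shrink (Suc k # a) = k # shrink a"
  "shrink (a @ b) = shrink a @ shrink b"
  "shrink (replicate j 0) = []"
  by (simp_all add: shrink_def)

lemma length_shrink_le: "length (shrink a) \<le> length a"
  by (simp add: shrink_def)

lemma shrink_map_Suc [simp]: "shrink (map Suc a) = a"
  by (induction a) simp_all

lemma map_Suc_shrink: "0 \<notin> set a \<Longrightarrow> map Suc (shrink a) = a"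
  by (induction a) (auto simp: shrink_def)

lemma set_shrink: "k \<in> set (shrink a) \<longleftrightarrow> Suc k \<in> set a"
  by (force simp: shrink_def image_iff)

lemma takeWhile_shrink:
  "takeWhile (\<lambda>x. x \<noteq> k) (shrink a) = shrink (takeWhile (\<lambda>x. x \<noteq> Suc k) a)"
proof (induction a)
  case (Cons x a) then show ?case by (cases x) simp_all
qed simp

lemma dropWhile_shrink:
  "dropWhile (\<lambda>x. x \<noteq> k) (shrink a) = shrink (dropWhile (\<lambda>x. x \<noteq> Suc k) a)"
proof (induction a)
  case (Cons x a) then show ?case by (cases x) simp_all
qed simp

text \<open>The condition on the letter \<open>k + 2\<close> of \<open>a\<close> is the condition on the letter \<open>k + 1\<close> of \<open>shrink a\<close>, so only
  the letter one adds something.\<close>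
lemma supported_iff_shrink:
  "supported a \<longleftrightarrow> supported (shrink a) \<and>
     (1 \<in> set a \<longrightarrow> 0 \<in> set (takeWhile (\<lambda>x. x \<noteq> 1) a) \<and> 0 \<in> set (dropWhile (\<lambda>x. x \<noteq> 1) a))"
  (is "_ \<longleftrightarrow> _ \<and> ?one")
proof -
  define Q where "Q k \<longleftrightarrow> (Suc k \<in> set a \<longrightarrow>
     k \<in> set (takeWhile (\<lambda>x. x \<noteq> Suc k) a) \<and> k \<in> set (dropWhile (\<lambda>x. x \<noteq> Suc k) a))" for k
  have "supported a \<longleftrightarrow> (\<forall>k. Q k)"
    by (simp add: supported_def Q_def)
  also have "\<dots> \<longleftrightarrow> (\<forall>k. Q (Suc k)) \<and> Q 0"
    by (metis old.nat.exhaust)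
  also have "(\<forall>k. Q (Suc k)) \<longleftrightarrow> supported (shrink a)"
    by (simp add: supported_def Q_def takeWhile_shrink dropWhile_shrink set_shrink)
  also have "Q 0 \<longleftrightarrow> ?one"
    by (simp add: Q_def)
  finally show ?thesis .
qed

text \<open>Two letters that become neighbours when zeros are deleted were separated by a zero, so the left one
  was at most one and becomes zero.\<close>
lemma gentle_shrink: "gentle a \<Longrightarrow> gentle (shrink a)"
proof (induction a)
  case (Cons x a)
  then have IH: "gentle (shrink a)" by (auto simp: successively_Cons)
  show ?case
  proof (cases x)
    case 0
    then show ?thesis using IH by simp
  next
    case (Suc k)
    have "k \<le> hd (shrink a) + 1" if "shrink a \<noteq> []"
    proof (cases "k = 0")
      case False
      with that Cons.prems Suc obtain y b where "a = Suc y # b" "x \<le> Suc y + 1"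
        by (cases a; cases "hd a") (auto simp: successively_Cons)
      then show ?thesis using Suc by simp
    qed simp
    then show ?thesis using IH Suc by (auto simp: successively_Cons)
  qed
qed simp

lemma split_at_first:
  assumes "x \<notin> set p"
  shows "takeWhile (\<lambda>y. y \<noteq> x) (p @ x # s) = p"
    and "dropWhile (\<lambda>y. y \<noteq> x) (p @ x # s) = x # s"
  using assms by (induction p) auto

lemma supported_hd: "supported a \<Longrightarrow> a \<noteq> [] \<Longrightarrow> hd a = 0"
proof (cases a)
  fix x b assume "supported a" "a = x # b"
  then show "hd a = 0" by (cases x) (auto simp: supported_def)
qed simp

lemma nonzero_hd_Cons:
  assumes "w \<noteq> []" "hd w \<noteq> (0 :: nat)"
  obtains k v where "w = Suc k # v"
  using assms by (cases w; cases "hd w") simp_all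

lemma zero_block_split:
  fixes a :: "nat list"
  obtains j w where "a = replicate j 0 @ w" "w = [] \<or> hd w \<noteq> 0"
proof
  show "a = replicate (length (takeWhile (\<lambda>x. x = 0) a)) 0 @ dropWhile (\<lambda>x. x = 0) a"
    by (induction a) auto
  show "dropWhile (\<lambda>x. x = 0) a = [] \<or> hd (dropWhile (\<lambda>x. x = 0) a) \<noteq> 0"
    using hd_dropWhile by blast
qed

lemma gentle_zeros_append: "gentle (replicate j 0 @ w) \<longleftrightarrow> gentle w"
  by (induction j) (auto simp: successively_Cons)

lemma gentle_zeros [simp]: "gentle (replicate j 0)"
  using gentle_zeros_append[of j "[]"] by simp

text \<open>The ways to put zeros back into \<open>b\<close>, with those at the front (\<open>fillings\<close>) or without them
  (\<open>inner_fillings\<close>).\<close>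
definition fillings :: "nat list \<Rightarrow> nat list set" where
  "fillings b = {w. shrink w = b \<and> gentle w}"

definition inner_fillings :: "nat list \<Rightarrow> nat list set" where
  "inner_fillings b = {w \<in> fillings b. w = [] \<or> hd w \<noteq> 0}"

lemma graded_finite_fillings: "graded_finite (fillings b)"
  unfolding graded_finite_def
proof
  fix k
  have "x \<in> insert 0 (Suc ` set b)" if "w \<in> fillings b" "x \<in> set w" for w x
    using that by (cases x) (auto simp: fillings_def set_shrink)
  then have "{w \<in> fillings b. length w \<le> k}
      \<subseteq> {w. set w \<subseteq> insert 0 (Suc ` set b) \<and> length w \<le> k}" by blast
  then show "finite {w \<in> fillings b. length w \<le> k}"
    by (rule finite_subset) (intro finite_lists_length_le, simp)
qed

lemma graded_finite_inner_fillings: "graded_finite (inner_fillings b)"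
  by (rule graded_finite_subset[OF graded_finite_fillings]) (auto simp: inner_fillings_def)

lemma fillings_eq_zero_padded: "fillings b = zero_padded (inner_fillings b)"
proof (intro equalityI subsetI)
  fix a assume a: "a \<in> fillings b"
  obtain j w where w: "a = replicate j 0 @ w" "w = [] \<or> hd w \<noteq> 0"
    by (rule zero_block_split)
  then have "w \<in> inner_fillings b"
    using a by (simp add: fillings_def inner_fillings_def gentle_zeros_append)
  then show "a \<in> zero_padded (inner_fillings b)"
    unfolding w(1) by (rule zero_paddedI)
qed (auto simp: zero_padded_def fillings_def inner_fillings_def gentle_zeros_append)

lemma inner_fillings_Nil: "inner_fillings [] = {[]}"
proof (intro equalityI subsetI)
  fix w assume "w \<in> inner_fillings []"
  then have w: "shrink w = []" "w = [] \<or> hd w \<noteq> 0"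
    by (simp_all add: inner_fillings_def fillings_def)
  show "w \<in> {[]}"
  proof (cases w)
    case (Cons x v)
    then show ?thesis using w by (cases x) simp_all
  qed simp
qed (simp add: inner_fillings_def fillings_def)

text \<open>Behind the first letter zeros may follow exactly if that letter is \<open>0\<close> in \<open>b\<close>, that is \<open>1\<close> in the
  filling. In the other case the descent condition on \<open>k # b\<close> guarantees that no new descent is
  too large.\<close>
lemma inner_fillings_Cons:
  assumes "gentle (k # b)"
  shows "inner_fillings (k # b) = (#) (Suc k) ` (if k = 0 then fillings b else inner_fillings b)"
proof (intro equalityI subsetI)
  fix w assume "w \<in> inner_fillings (k # b)"
  then have w: "shrink w = k # b" "gentle w" "w = [] \<or> hd w \<noteq> 0"
    by (simp_all add: inner_fillings_def fillings_def)
  obtain v where v: "w = Suc k # v"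
  proof (cases w)
    case (Cons x v)
    then show ?thesis using w that by (cases x) simp_all
  qed (use w in simp)
  have "v = [] \<or> k \<le> hd v" "gentle v" "shrink v = b"
    using w unfolding v by (auto simp: successively_Cons)
  then have "v \<in> (if k = 0 then fillings b else inner_fillings b)"
    by (auto simp: inner_fillings_def fillings_def)
  then show "w \<in> (#) (Suc k) ` (if k = 0 then fillings b else inner_fillings b)"
    unfolding v by (rule imageI)
next
  fix w assume "w \<in> (#) (Suc k) ` (if k = 0 then fillings b else inner_fillings b)"
  then obtain v where v: "w = Suc k # v" "v \<in> (if k = 0 then fillings b else inner_fillings b)"
    by blast
  then have f: "shrink v = b" "gentle v" "k \<noteq> 0 \<Longrightarrow> v = [] \<or> hd v \<noteq> 0"
    by (simp_all add: inner_fillings_def fillings_def split: if_splits)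
  have "k \<le> hd v" if "v \<noteq> []"
  proof (cases "k = 0")
    case False
    with f(3) that have "hd v \<noteq> 0" by simp
    with that obtain y v' where "v = Suc y # v'"
      using nonzero_hd_Cons by blast
    with f(1) assms show ?thesis by (auto simp: successively_Cons)
  qed simp
  then have "v = [] \<or> k \<le> hd v" by blast
  with f(1,2) v(1) show "w \<in> inner_fillings (k # b)"
    by (simp add: inner_fillings_def fillings_def successively_Cons)
qed

text \<open>Each zero of \<open>b\<close> offers one place for arbitrarily many zeros, hence one factor
  \<open>p = 1 / (1 - x u)\<close>: filling replaces the mark \<open>u\<close> of a zero by \<open>p\<close>.\<close>
lemma weight_series_inner_fillings:
  assumes "gentle b" and p: "p * (1 - fps_X * u) = 1"
  shows "weight_series (inner_fillings b) u = weight p b"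
  using assms(1)
proof (induction b)
  case Nil
  then show ?case by (simp add: inner_fillings_Nil weight_series_singleton weight_def)
next
  case (Cons k b)
  then have IH: "weight_series (inner_fillings b) u = weight p b"
    by (auto simp: successively_Cons)
  have "(1 - fps_X * u) * weight_series (fillings b) u = weight_series (inner_fillings b) u"
    unfolding fillings_eq_zero_padded
    by (rule weight_series_zero_padded[OF graded_finite_inner_fillings])
      (simp add: inner_fillings_def)
  then have "p * (1 - fps_X * u) * weight_series (fillings b) u = p * weight p b"
    by (simp add: IH mult.assoc)
  then have fill: "weight_series (fillings b) u = p * weight p b"
    by (simp add: p)
  show ?case
    unfolding inner_fillings_Cons[OF Cons.prems]
    by (simp add: weight_series_Cons graded_finite_fillings graded_finite_inner_fillings
        fill IH weight_Cons)
qed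

text \<open>What is left of a nonempty word of the language after its initial zeros: nothing, or a filling of a
  shorter word with at least one zero inside. The only inner filling without such a zero is \<open>map Suc b\<close>, and
  it is excluded because the first one of a word needs a zero to its right.\<close>
definition cores :: "nat list set" where
  "cores = insert [] (\<Union>b \<in> language - {[]}. inner_fillings b - {map Suc b})"

lemma language_eq_zero_padded_cores: "language - {[]} = (#) 0 ` zero_padded cores"
proof (intro equalityI subsetI)
  fix a assume "a \<in> language - {[]}"
  then have a: "gentle a" "supported a" "a \<noteq> []" by (simp_all add: language_def)
  obtain a' where a': "a = 0 # a'"
    using supported_hd[OF a(2,3)] a(3) by (cases a) simp_all
  obtain j w where a'w: "a' = replicate j 0 @ w" and w: "w = [] \<or> hd w \<noteq> 0"
    by (rule zero_block_split)
  have aw: "a = replicate (Suc j) 0 @ w" by (simp add: a' a'w)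
  have gentle: "gentle w" using a(1) unfolding aw gentle_zeros_append .
  have "w \<in> cores"
  proof (cases "w = []")
    case False
    define b where "b = shrink w"
    have b: "shrink a = b" by (simp add: aw b_def)
    have "supported b" using a(2) unfolding supported_iff_shrink[of a] b by blast
    moreover have "gentle b" using gentle_shrink[OF a(1)] unfolding b .
    ultimately have lang: "b \<in> language" by (simp add: language_def)
    obtain k v where v: "w = Suc k # v"
      using False w nonzero_hd_Cons by blast
    have tw: "takeWhile (\<lambda>x. x \<noteq> Suc k) a = replicate (Suc j) 0"
      and dw: "dropWhile (\<lambda>x. x \<noteq> Suc k) a = w"
      unfolding aw v by (rule split_at_first; simp)+
    have "Suc k \<in> set a" by (simp add: aw v)
    then have "k \<in> set (replicate (Suc j) 0)" "k \<in> set w"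
      using a(2) unfolding supported_def tw[symmetric] dw[symmetric] by blast+
    moreover from \<open>k \<in> set (replicate (Suc j) 0)\<close> have "k = 0" by (metis in_set_replicate)
    ultimately have "0 \<in> set w" by simp
    moreover have "0 \<notin> set (map Suc b)" by simp
    ultimately have "w \<noteq> map Suc b" by metis
    moreover have "w \<in> inner_fillings b"
      using gentle w by (simp add: inner_fillings_def fillings_def b_def)
    moreover have "b \<noteq> []" by (simp add: b_def v)
    ultimately show ?thesis
      unfolding cores_def using lang by (intro insertI2 UN_I[of b]) simp_all
  qed (simp add: cores_def)
  then show "a \<in> (#) 0 ` zero_padded cores"
    unfolding a' a'w by (intro imageI zero_paddedI)
next
  fix a assume "a \<in> (#) 0 ` zero_padded cores"
  then obtain j w where "a = 0 # (replicate j 0 @ w)" and w: "w \<in> cores"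
    unfolding zero_padded_def by blast
  then have a: "a = replicate (Suc j) 0 @ w" by simp
  have "a \<noteq> []" by (simp add: a)
  moreover have "gentle a \<and> supported a"
  proof (cases "w = []")
    case True
    have "supported a" by (simp add: a True supported_def)
    moreover have "gentle a" unfolding a True using gentle_zeros[of "Suc j"] by simp
    ultimately show ?thesis by blast
  next
    case False
    with w obtain b where b: "b \<in> language" "b \<noteq> []" "w \<in> inner_fillings b" "w \<noteq> map Suc b"
      unfolding cores_def by (elim insertE UN_E DiffE) simp_all
    then have s: "shrink w = b" "gentle w" "hd w \<noteq> 0"
      using False by (simp_all add: inner_fillings_def fillings_def)
    have zero: "0 \<in> set w"
      using b(4) map_Suc_shrink[of w] unfolding s(1) by metis
    obtain k v where v: "w = Suc k # v"
      using False s(3) by (rule nonzero_hd_Cons)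
    have "supported b" using b(1) by (simp add: language_def)
    then have "hd b = 0" using b(2) by (rule supported_hd)
    moreover have "b = k # shrink v" using s(1) unfolding v by simp
    ultimately have "k = 0" by simp
    have "Suc 0 \<notin> set (replicate (Suc j) 0)" by simp
    then have "takeWhile (\<lambda>x. x \<noteq> 1) a = replicate (Suc j) 0" "dropWhile (\<lambda>x. x \<noteq> 1) a = w"
      unfolding a v \<open>k = 0\<close> One_nat_def by (rule split_at_first)+
    moreover have "shrink a = b" using s(1) by (simp add: a)
    ultimately have "supported a"
      using zero \<open>supported b\<close> by (subst supported_iff_shrink) simp
    moreover have "gentle a" unfolding a gentle_zeros_append by (rule s)
    ultimately show ?thesis by blast
  qed
  ultimately show "a \<in> language - {[]}" by (simp add: language_def)
qed


section \<open>The words described by positions\<close>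

lemma gentle_iff_nth: "gentle a \<longleftrightarrow> (\<forall>i. Suc i < length a \<longrightarrow> a ! i \<le> a ! Suc i + 1)"
proof (induction a rule: induct_list012)
  case (3 x y a)
  have "(\<forall>i. Suc i < length (x # y # a) \<longrightarrow> (x # y # a) ! i \<le> (x # y # a) ! Suc i + 1)
      \<longleftrightarrow> (\<forall>i < Suc (length a). (x # y # a) ! i \<le> (x # y # a) ! Suc i + 1)"
    by simp
  also have "\<dots> \<longleftrightarrow> x \<le> Suc y \<and> (\<forall>i < length a. (y # a) ! i \<le> (y # a) ! Suc i + 1)"
    unfolding All_less_Suc2 by simp
  finally show ?case
    using "3.IH"(2) by simp
qed simp_all

lemma supported_iff_nth:
  "supported a \<longleftrightarrow> (\<forall>i < length a. a ! i > 0 \<and> (\<forall>j < i. a ! j \<noteq> a ! i) \<longrightarrow>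
     (\<exists>i1 i2. i1 < i \<and> i < i2 \<and> i2 < length a \<and> a ! i1 = a ! i - 1 \<and> a ! i2 = a ! i - 1))"
  (is "_ = ?R")
proof
  assume supp: "supported a"
  show ?R
  proof (intro allI impI)
    fix i assume i: "i < length a" and first: "a ! i > 0 \<and> (\<forall>j < i. a ! j \<noteq> a ! i)"
    from first have "a ! i > 0" ..
    then obtain k where k: "a ! i = Suc k" by (cases "a ! i") simp_all
    define p s where "p = take i a" and "s = drop (Suc i) a"
    have a: "a = p @ Suc k # s"
      using id_take_nth_drop[OF i] by (simp add: p_def s_def k)
    have p: "length p = i" using i by (simp add: p_def)
    have "Suc k \<notin> set p"
    proof
      assume "Suc k \<in> set p"
      then obtain j where "j < i" "a ! j = Suc k"
        using i by (auto simp: p_def in_set_conv_nth)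
      with first k show False by simp
    qed
    then have split: "takeWhile (\<lambda>x. x \<noteq> Suc k) a = p" "dropWhile (\<lambda>x. x \<noteq> Suc k) a = Suc k # s"
      unfolding a by (rule split_at_first; assumption)+
    have "Suc k \<in> set a" by (simp add: a)
    with supp have "k \<in> set (takeWhile (\<lambda>x. x \<noteq> Suc k) a)" "k \<in> set (dropWhile (\<lambda>x. x \<noteq> Suc k) a)"
      unfolding supported_def by blast+
    then have "k \<in> set p" "k \<in> set s" unfolding split by simp_all
    then obtain i1 i2 where "i1 < length p" "p ! i1 = k" "i2 < length s" "s ! i2 = k"
      unfolding in_set_conv_nth by blast
    then have "i1 < i \<and> i < Suc (i + i2) \<and> Suc (i + i2) < length a \<and> a ! i1 = k \<and> a ! Suc (i + i2) = k"
      by (simp add: a nth_append flip: p)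
    then show "\<exists>i1 i2. i1 < i \<and> i < i2 \<and> i2 < length a \<and> a ! i1 = a ! i - 1 \<and> a ! i2 = a ! i - 1"
      unfolding k diff_Suc_1 by blast
  qed
next
  assume R: ?R
  show "supported a"
    unfolding supported_def
  proof (intro allI impI)
    fix k assume "Suc k \<in> set a"
    then obtain p s where a: "a = p @ Suc k # s" and p: "Suc k \<notin> set p"
      by (meson split_list_first)
    have nth: "a ! length p = Suc k" by (simp add: a)
    have "a ! j \<noteq> Suc k" if "j < length p" for j
    proof -
      have "a ! j = p ! j" using that by (simp add: a nth_append)
      then show ?thesis using p nth_mem[OF that] by metis
    qed
    then have first: "a ! length p > 0 \<and> (\<forall>j < length p. a ! j \<noteq> a ! length p)"
      by (simp add: nth)
    have "length p < length a" by (simp add: a)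
    from R[THEN spec, THEN mp, OF this, THEN mp, OF first]
    obtain i1 i2 where i: "i1 < length p" "length p < i2" "i2 < length a" "a ! i1 = k" "a ! i2 = k"
      unfolding nth diff_Suc_1 by blast
    have "a ! i1 = p ! i1" using i(1) by (simp add: a nth_append)
    then have "k \<in> set p" using nth_mem[OF i(1)] i(4) by simp
    moreover have "k \<in> set s"
    proof -
      obtain d where d: "i2 = Suc (length p + d)"
        using i(2) less_imp_Suc_add by blast
      then have "d < length s" "s ! d = k"
        using i(3,5) by (simp_all add: a nth_append)
      then show ?thesis using nth_mem by blast
    qed
    ultimately show "k \<in> set (takeWhile (\<lambda>x. x \<noteq> Suc k) a) \<and> k \<in> set (dropWhile (\<lambda>x. x \<noteq> Suc k) a)"
      by (simp add: a split_at_first[OF p])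
  qed
qed

lemma L_words_eq: "L_words n = {a \<in> language. length a = n}"
proof (intro set_eqI)
  fix a
  show "a \<in> L_words n \<longleftrightarrow> a \<in> {a \<in> language. length a = n}"
  proof (cases "length a = n")
    case True
    show ?thesis
      unfolding L_words_def language_def gentle_iff_nth supported_iff_nth mem_Collect_eq
        True[symmetric] by simp
  qed (simp add: L_words_def)
qed

lemma graded_finite_language: "graded_finite language"
  unfolding graded_finite_def
proof
  fix k
  have "{a \<in> language. length a \<le> k} = (\<Union>n\<le>k. L_words n)"
    by (auto simp: L_words_eq)
  then show "finite {a \<in> language. length a \<le> k}"
    by (simp add: finite_L_words)
qed


section \<open>A recurrence for an arbitrary second argument\<close>

text \<open>The excluded fillings \<open>map Suc b\<close> contain no zero, so their weight is that of \<open>b\<close> with zeros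
  unmarked. This is the origin of the term at \<open>1\<close>, which counts all words by length.\<close>
lemma weight_series_cores:
  assumes p: "p * (1 - fps_X * u) = 1"
  shows "graded_finite cores"
    and "weight_series cores u
      = 1 + weight_series (language - {[]}) p - weight_series (language - {[]}) 1"
proof -
  let ?B = "language - {[]}" and ?E = "\<lambda>b. inner_fillings b - {map Suc b}"
  have fin: "graded_finite ?B" "graded_finite (?E b)" for b
    by (rule graded_finite_subset[OF graded_finite_language], blast)
      (rule graded_finite_subset[OF graded_finite_inner_fillings], blast)
  have len: "length b \<le> length w" if "w \<in> ?E b" for b w
    using that length_shrink_le[of w] by (auto simp: inner_fillings_def fillings_def)
  have finU: "graded_finite (\<Union>b\<in>?B. ?E b)"
    by (intro graded_finite_UN fin len)
  have cores_Un: "cores = {[]} \<union> (\<Union>b\<in>?B. ?E b)"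
    by (simp add: cores_def)
  show "graded_finite cores"
    using finU unfolding cores_Un by (intro graded_finite_Un graded_finite_singleton)
  have disj: "?E b \<inter> ?E c = {}" if "b \<noteq> c" for b c
    using that by (simp add: inner_fillings_def fillings_def) blast
  have wE: "weight_series (?E b) u = weight p b - weight 1 b" if "b \<in> ?B" for b
  proof -
    have "gentle b" using that by (simp add: language_def)
    then have "gentle (map Suc b)" by (simp add: successively_map)
    moreover have "map Suc b = [] \<or> hd (map Suc b) \<noteq> 0" by (cases b) simp_all
    ultimately have "map Suc b \<in> inner_fillings b"
      by (simp add: inner_fillings_def fillings_def)
    then have "weight_series (?E b) u = weight p b - weight u (map Suc b)"
      using weight_series_inner_fillings[OF \<open>gentle b\<close> p]
      by (simp add: weight_series_remove graded_finite_inner_fillings)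
    moreover have "count_list (map Suc b) 0 = 0"
      by (induction b) auto
    ultimately show ?thesis by (simp add: weight_def)
  qed
  have "weight_series (\<Union>b\<in>?B. ?E b) u = weight_series ?B p - weight_series ?B 1"
  proof (rule fps_ext)
    fix k
    have "weight_series (\<Union>b\<in>?B. ?E b) u $ k
        = (\<Sum>b | b \<in> ?B \<and> length b \<le> k. weight_series (?E b) u $ k)"
      by (intro weight_series_UN_nth fin len disj)
    also have "\<dots> = (\<Sum>b | b \<in> ?B \<and> length b \<le> k. weight p b $ k - weight 1 b $ k)"
      by (intro sum.cong refl) (simp add: wE)
    also have "\<dots> = (weight_series ?B p - weight_series ?B 1) $ k"
      by (simp add: weight_series_def sum_subtractf)
    finally show "weight_series (\<Union>b\<in>?B. ?E b) u $ k
        = (weight_series ?B p - weight_series ?B 1) $ k" .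
  qed
  moreover have "weight_series cores u = weight_series {[]} u + weight_series (\<Union>b\<in>?B. ?E b) u"
    unfolding cores_Un
    by (intro weight_series_Un graded_finite_singleton finU)
      (auto simp: inner_fillings_def fillings_def)
  ultimately show "weight_series cores u = 1 + weight_series ?B p - weight_series ?B 1"
    by (simp add: weight_series_singleton weight_def)
qed

lemma language_functional_equation:
  assumes p: "p * (1 - fps_X * u) = 1"
  shows "(1 - fps_X * u) * weight_series (language - {[]}) u
    = fps_X * u * (1 + weight_series (language - {[]}) p - weight_series (language - {[]}) 1)"
proof -
  note cores = weight_series_cores[OF p]
  have "(0 :: nat) # w \<notin> cores" for w
    by (auto simp: cores_def inner_fillings_def)
  then have "(1 - fps_X * u) * weight_series (zero_padded cores) u = weight_series cores u"
    by (intro weight_series_zero_padded cores)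
  moreover have "weight_series (language - {[]}) u
      = fps_X * u * weight_series (zero_padded cores) u"
    unfolding language_eq_zero_padded_cores
    by (simp add: weight_series_Cons graded_finite_zero_padded cores(1))
  ultimately show ?thesis
    unfolding cores(2)[symmetric] by (simp add: mult.left_commute)
qed


text \<open>The empty word must go because the sum over \<open>m\<close> starts at one. A word with letters begins with a
  zero, so it is counted on the right.\<close>
lemma sum_weight_L_words:
  "(\<Sum>w \<in> L_words n - {[]}. weight u w)
     = (\<Sum>m=1..n. of_nat (num_words n m) * fps_X ^ n * u ^ m)"
proof -
  have fin: "finite (L_words n - {[]})" by (simp add: finite_L_words)
  have count: "count_list w 0 \<in> {1..n}" if w: "w \<in> L_words n - {[]}" for w
  proof -
    have "hd w = 0" "w \<noteq> []" "length w = n"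
      using w supported_hd by (auto simp: L_words_eq language_def)
    then have "0 \<in> set w" by (metis hd_in_set)
    then show ?thesis
      using count_le_length[of w 0] \<open>length w = n\<close> by (simp add: Suc_le_eq) (metis count_list_0_iff neq0_conv)
  qed
  have "(\<Sum>w \<in> L_words n - {[]}. weight u w)
      = (\<Sum>m=1..n. \<Sum>w | w \<in> L_words n - {[]} \<and> count_list w 0 = m. weight u w)"
    by (intro sum.group[symmetric] fin) (use count in blast)+
  also have "\<dots> = (\<Sum>m=1..n. \<Sum>w | w \<in> L_words n \<and> count_list w 0 = m. fps_X ^ n * u ^ m)"
    by (intro sum.cong refl) (auto simp: weight_def L_words_eq)
  finally show ?thesis
    by (simp add: num_words_def mult.assoc)
qed

lemma A_series_eq_weight_series: "A_series u = weight_series (language - {[]}) u"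
proof (rule fps_ext)
  fix k
  let ?B = "language - {[]}"
  define t where "t n = (\<Sum>m=1..n. of_nat (num_words n m) * X_var ^ n * u ^ m)" for n
  have fin: "graded_finite ?B"
    by (rule graded_finite_subset[OF graded_finite_language]) auto
  have partial: "(\<Sum>n<Suc K. t n) = (\<Sum>w | w \<in> ?B \<and> length w \<le> K. weight u w)" for K
  proof -
    have "(\<Sum>w | w \<in> ?B \<and> length w \<le> K. weight u w)
        = (\<Sum>n<Suc K. \<Sum>w | w \<in> {w. w \<in> ?B \<and> length w \<le> K} \<and> length w = n. weight u w)"
      by (intro sum.group[symmetric] graded_finiteD[OF fin]) auto
    also have "\<dots> = (\<Sum>n<Suc K. \<Sum>w \<in> L_words n - {[]}. weight u w)"
      by (intro sum.cong refl) (auto simp: L_words_eq)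
    finally show ?thesis unfolding t_def sum_weight_L_words ..
  qed
  have "(\<lambda>N. \<Sum>n<N. t n) \<longlonglongrightarrow> A_series u"
    using A_series_sums[of u] unfolding sums_def t_def .
  then have "\<forall>\<^sub>F N in sequentially. (\<Sum>n<N. t n) $ k = A_series u $ k"
    unfolding tendsto_fps_iff by blast
  then have "\<forall>\<^sub>F N in sequentially. (\<Sum>n<N. t n) $ k = A_series u $ k \<and> k < N"
    using eventually_gt_at_top[of k] by (rule eventually_conj)
  then obtain N where N: "(\<Sum>n<N. t n) $ k = A_series u $ k" "k < N"
    unfolding eventually_sequentially by blast
  then obtain K where K: "N = Suc K" "k \<le> K" by (cases N) auto
  show "A_series u $ k = weight_series ?B u $ k"
    using N(1) unfolding K(1) partial weight_series_nth_truncate[OF fin K(2)] by simp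
qed


section \<open>Solving the functional equation\<close>

text \<open>The coefficients \<open>rat fps\<close> do not form a field, so division of series is not governed by the laws
  of fields. Only this cancellation rule for series with constant term one is used.\<close>
lemma divide_one_minus_X_mult:
  fixes f u :: "rat fps fps"
  shows "f / (1 - X_var * u) * (1 - X_var * u) = f"
proof -
  let ?g = "1 - X_var * u"
  have g0: "?g $ 0 = 1" by simp
  have "inverse (1 :: rat fps) = 1" by simp
  then have "inverse ?g = fps_right_inverse ?g 1"
    by (simp only: fps_inverse_def[of ?g] g0)
  then have "inverse ?g * ?g = 1"
    using fps_right_inverse[of ?g 1] by (simp add: mult.commute)
  with g0 show ?thesis
    by (simp add: fps_divide_unit mult.assoc)
qed

lemma A_series_recurrence:
  "(1 - X_var * u) * A_series u
     = X_var * u * (1 + A_series (1 / (1 - X_var * u)) - A_series 1)"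
  unfolding A_series_eq_weight_series
  by (rule language_functional_equation) (rule divide_one_minus_X_mult)

lemma one_minus_X_mult_nonzero: "1 - X_var * u \<noteq> 0"
proof
  assume "1 - X_var * u = 0"
  then have "(1 - X_var * u) $ 0 = 0 $ 0" by simp
  then show False by simp
qed

text \<open>\<open>B\<close> is the generating function of the ballot numbers, which the \<open>a(n,m)\<close> turn out to be. After
  multiplication by the denominators \<open>1 - xCu\<close> of \<open>B u\<close> and \<open>1 - xu - xC\<close> of \<open>B p\<close>, where
  \<open>p = 1 / (1 - xu)\<close>, the recurrence is a polynomial consequence of \<open>C = 1 + xC\<^sup>2\<close>.\<close>
lemma ballot_series_recurrence:
  fixes u :: "rat fps fps"
  defines "B \<equiv> \<lambda>u. X_var * u / (1 - X_var * (catalan_fps * u))"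
  shows "(1 - X_var * u) * B u
     = X_var * u * (1 + B (1 / (1 - X_var * u)) - X_var * catalan_fps)"
proof -
  define x C p where "x = X_var" and "C = catalan_fps" and "p = 1 / (1 - x * u)"
  have p: "p * (1 - x * u) = 1"
    unfolding p_def x_def by (rule divide_one_minus_X_mult)
  have C: "C = 1 + x * C\<^sup>2"
    unfolding C_def x_def by (rule catalan_fps_functional_equation)
  have B: "B v * (1 - x * (C * v)) = x * v" for v
    unfolding B_def x_def C_def by (rule divide_one_minus_X_mult)
  have Bp: "B p * (1 - x * u - x * C) = x"
  proof -
    have "B p * (1 - x * u - x * C) = B p * (1 - x * (C * p)) * (1 - x * u)"
      using p by algebra
    also have "\<dots> = x" unfolding B using p by algebra
    finally show ?thesis .
  qed
  have "(1 - x * u - x * C) * (1 - x * (C * u)) * ((1 - x * u) * B u)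
      = (1 - x * u - x * C) * (1 - x * (C * u)) * (x * u * (1 + B p - x * C))"
    using B[of u] Bp C by algebra
  moreover have "1 - x * (C * u) \<noteq> 0" "1 - x * (u + C) \<noteq> 0"
    unfolding x_def by (rule one_minus_X_mult_nonzero)+
  moreover have "1 - x * (u + C) = 1 - x * u - x * C" by (simp add: algebra_simps)
  ultimately show ?thesis
    unfolding x_def C_def p_def by simp
qed

text \<open>The difference \<open>D\<close> of \<open>A\<close> and the ballot series satisfies a homogeneous recurrence whose right-hand side
  has a factor \<open>x\<close>. If \<open>D(u)\<close> vanishes below order \<open>k\<close> for every \<open>u\<close>, it therefore vanishes below
  order \<open>k + 1\<close> for every \<open>u\<close>. The induction has to treat all \<open>u\<close> at once, as the recurrence changes
  the argument.\<close>
lemma A_series_at_one: "A_series 1 = X_var * catalan_fps"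
proof -
  define B where "B u = X_var * u / (1 - X_var * (catalan_fps * u))" for u
  define D where "D u = A_series u - B u" for u
  define phi where "phi u = 1 / (1 - X_var * u)" for u
  have B1: "B 1 = X_var * catalan_fps"
  proof -
    have "B 1 * (1 - X_var * catalan_fps) = X_var"
      using divide_one_minus_X_mult[of "X_var * 1" "catalan_fps * 1"] by (simp add: B_def)
    moreover have "X_var * catalan_fps * (1 - X_var * catalan_fps) = X_var"
      using catalan_fps_functional_equation by algebra
    ultimately show ?thesis
      using one_minus_X_mult_nonzero[of catalan_fps] by (metis mult_right_cancel)
  qed
  have D: "D u = X_var * (u * (D u + D (phi u) - D 1))" for u
  proof -
    have "(1 - X_var * u) * A_series u = X_var * u * (1 + A_series (phi u) - A_series 1)"
      unfolding phi_def by (rule A_series_recurrence)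
    moreover have "(1 - X_var * u) * B u = X_var * u * (1 + B (phi u) - X_var * catalan_fps)"
      unfolding phi_def B_def by (rule ballot_series_recurrence)
    ultimately show ?thesis unfolding D_def B1 by algebra
  qed
  have "D u $ k = 0" for u k
  proof (induction k arbitrary: u rule: less_induct)
    case (less k)
    show ?case
    proof (cases k)
      case 0
      then show ?thesis by (subst D) simp
    next
      case (Suc j)
      have "(u * (D u + D (phi u) - D 1)) $ j = (u * 0) $ j"
        using less.IH Suc by (intro fps_mult_nth_cong) simp
      then show ?thesis by (subst D) (simp add: Suc)
    qed
  qed
  then have "D 1 = 0" by (intro fps_ext) simp
  then show ?thesis by (simp add: D_def B1)
qed

theorem lemma2p5:
  shows "A_series V_var =
      X_var * V_var / (1 - X_var * V_var) * (1 - X_var * catalan_fps)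
    + X_var * V_var / (1 - X_var * V_var) * A_series (1 / (1 - X_var * V_var))"
proof -
  let ?q = "1 - X_var * V_var"
  have "X_var * V_var / ?q * (1 - X_var * catalan_fps) + X_var * V_var / ?q * A_series (1 / ?q)
      = X_var * V_var / ?q * (1 + A_series (1 / ?q) - A_series 1)"
    unfolding A_series_at_one by (simp only: distrib_left right_diff_distrib) simp
  also have "\<dots> * ?q = A_series V_var * ?q"
    using A_series_recurrence[of V_var] divide_one_minus_X_mult[of "X_var * V_var" V_var] by algebra
  finally show ?thesis
    using one_minus_X_mult_nonzero[of V_var] by (metis mult_right_cancel)
qed

end
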